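(* Let $S$ be a semiring with the common integer divisor property and let $\mathsf{M}_S$ be the multiset monad for $S$. Then for every natural number $n$, the set of natural transformations $(\mathsf{M}_S)^n\to\mathsf{M}_S$ is in one-to-one correspondence with the set of functions $\phi:S^n\to S^n$.
   Context: For a semiring $(S,+,\cdot,0,1)$, the multiset functor $\mathsf{M}_S:\mathbf{Set}\to\mathbf{Set}$ sends a set $X$ to the set of functions $\phi:X\to S$ with finite support, and a map $f:X\to Y$ to $\mathsf{M}_S f(\phi)=\lambda y.\sum_{x\in f^{-1}(\{y\})}\phi(x)$; its unit is $\eta_X(x)=\delta_x$ (value $1$ at $x$, $0$ elsewhere) and multiplication $\mu_X(\Phi)(x)=\sum_{\phi\in\mathrm{supp}(\Phi)}\Phi(\phi)\cdot\phi(x)$. $(\mathsf{M}_S)^n$ denotes the $n$-fold pointwise product functor. $S$ has the common integer divisor property if for all $x,y\in S$ there exist an invertible element $r\in S$ and $m,n\in\mathbb{N}$ such that $x=m.r:=r+\dots+r$ ($m$ times) and $y=n.r$.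
   Formalization: With 0 in N the claim fails for the Boolean semiring (n=1: 2 transformations, 4 functions), so S is also assumed infinite or to satisfy k.1=0 for some k>0; the category of sets is taken as all subsets of an arbitrary infinite set, which suffices as the functors are finitary. *)

theory Defs
  imports "HOL-Library.FuncSet"
begin

text \<open>
  The sort \<open>{semiring_0, monoid_mult}\<close> is that of (not necessarily commutative) semirings with
  0 and 1. The class \<open>semiring_1\<close> would in addition require 0 and 1 to be distinct.
\<close>

definition nat_multiple :: "nat \<Rightarrow> 's::comm_monoid_add \<Rightarrow> 's" where
  "nat_multiple m r = (\<Sum>i<m. r)"

definition invertible_elem :: "'s::monoid_mult \<Rightarrow> bool" where
  "invertible_elem r \<longleftrightarrow> (\<exists>s. r * s = 1 \<and> s * r = 1)"

definition common_integer_divisor :: "'s::{semiring_0, monoid_mult} itself \<Rightarrow> bool" where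
  "common_integer_divisor _ \<longleftrightarrow>
     (\<forall>x y :: 's. \<exists>r m n. invertible_elem r \<and> x = nat_multiple m r \<and> y = nat_multiple n r)"

text \<open>
  The objects of the category of sets are the subsets of an infinite type \<open>'u\<close> (the universe), and
  a morphism from \<open>X\<close> to \<open>Y\<close> is given by a function in \<open>X \<rightarrow> Y\<close>. A functor into sets is a pair of
  an action on objects and an action on morphisms; its values may live in another type.

  A finitely supported function on \<open>X\<close> is represented by its extension by 0 to all of \<open>'u\<close>.
  With this representation the action of a morphism does not depend on its codomain, nor on its
  values outside the domain.
\<close>

definition mset_obj :: "'u set \<Rightarrow> ('u \<Rightarrow> 's::comm_monoid_add) set" where
  "mset_obj X = {\<phi>. finite {x. \<phi> x \<noteq> 0} \<and> {x. \<phi> x \<noteq> 0} \<subseteq> X}"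

definition mset_map :: "('u \<Rightarrow> 'v) \<Rightarrow> ('u \<Rightarrow> 's::comm_monoid_add) \<Rightarrow> 'v \<Rightarrow> 's" where
  "mset_map f \<phi> = (\<lambda>y. \<Sum>x | \<phi> x \<noteq> 0 \<and> f x = y. \<phi> x)"

definition power_obj :: "nat \<Rightarrow> ('u set \<Rightarrow> 'a set) \<Rightarrow> 'u set \<Rightarrow> (nat \<Rightarrow> 'a) set" where
  "power_obj n F X = {..<n} \<rightarrow>\<^sub>E F X"

definition power_map ::
    "nat \<Rightarrow> (('u \<Rightarrow> 'u) \<Rightarrow> 'a \<Rightarrow> 'a) \<Rightarrow> ('u \<Rightarrow> 'u) \<Rightarrow> (nat \<Rightarrow> 'a) \<Rightarrow> nat \<Rightarrow> 'a" where
  "power_map n F f t = (\<lambda>i\<in>{..<n}. F f (t i))"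

definition natural_transformations ::
    "('u set \<Rightarrow> 'a set) \<Rightarrow> (('u \<Rightarrow> 'u) \<Rightarrow> 'a \<Rightarrow> 'a) \<Rightarrow>
     ('u set \<Rightarrow> 'b set) \<Rightarrow> (('u \<Rightarrow> 'u) \<Rightarrow> 'b \<Rightarrow> 'b) \<Rightarrow> ('u set \<Rightarrow> 'a \<Rightarrow> 'b) set" where
  "natural_transformations Fo Fm Go Gm =
     {\<alpha>. (\<forall>X. \<alpha> X \<in> Fo X \<rightarrow>\<^sub>E Go X) \<and>
          (\<forall>X Y. \<forall>f \<in> X \<rightarrow> Y. \<forall>t \<in> Fo X. \<alpha> Y (Fm f t) = Gm f (\<alpha> X t))}"

definition tuples :: "nat \<Rightarrow> (nat \<Rightarrow> 's) set" where
  "tuples n = {..<n} \<rightarrow>\<^sub>E UNIV"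

end

theory Submission
  imports Defs
begin

text \<open>
  Collapsing all points but one shows that a natural transformation \<open>\<alpha>\<close> is determined by the
  function \<open>G v w\<close>, its value at the first point of the configuration with weights \<open>v\<close>, \<open>w\<close> in
  \<open>S\<^sup>n\<close> at two points. Merging two of three points gives
  \<open>G (v + v') w = G v (v' + w) + G v' (v + w)\<close>, so \<open>G\<close> is additive in \<open>v\<close> as long as the total
  weight is fixed. Splitting the weights into multiples of units yields
  \<open>G v w = (\<Sum>i. v i * \<psi> (v + w) i)\<close>, where \<open>\<psi> t i\<close> is arbitrary if \<open>t i\<close> has a unit as a summand
  and is irrelevant otherwise. The common divisor property makes \<open>S\<close> additively cancellative, so
  that \<open>\<psi>\<close> is well defined. Only 0 can fail to have a unit as a summand, and then \<open>S\<close> is infinite, so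
  that restricting \<open>\<psi>\<close> does not change the number of functions.
\<close>

section \<open>Multiples of units\<close>

lemma nat_multiple_0 [simp]: "nat_multiple 0 r = 0"
  by (simp add: nat_multiple_def)

lemma nat_multiple_Suc [simp]: "nat_multiple (Suc m) r = r + nat_multiple m r"
  by (simp add: nat_multiple_def add.commute)

lemma nat_multiple_add: "nat_multiple (m + k) r = nat_multiple m r + nat_multiple k r"
  by (induction m) (simp_all add: add.assoc)

lemma nat_multiple_zero [simp]: "nat_multiple m 0 = 0"
  by (induction m) simp_all

lemma nat_multiple_mult: "nat_multiple (m * k) r = nat_multiple m (nat_multiple k r)"
  by (induction m) (simp_all add: nat_multiple_add)

lemma nat_multiple_mult_left:
  fixes x y :: "'s::semiring_0"
  shows "nat_multiple m x * y = nat_multiple m (x * y)"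
  by (induction m) (simp_all add: distrib_right)

lemma nat_multiple_one_mult:
  fixes y :: "'s::{semiring_0, monoid_mult}"
  shows "nat_multiple m 1 * y = nat_multiple m y"
  by (simp add: nat_multiple_mult_left)

section \<open>Common divisors and additive cancellation\<close>

lemma trivial_if_zero_invertible:
  fixes x y :: "'s::{semiring_0, monoid_mult}"
  assumes "invertible_elem (0::'s)"
  shows "x = y"
proof -
  have "(0::'s) = 1"
    using assms by (auto simp: invertible_elem_def)
  then show ?thesis
    by (metis mult_1_left mult_zero_left)
qed

text \<open>Induction on \<open>F\<close>: the divisor \<open>r\<close> found so far and the new
  element have a common unit divisor \<open>q\<close>, and multiples of \<open>r\<close> are again
  multiples of \<open>q\<close>.\<close>

lemma common_divisor_finite_set:
  fixes F :: "'s::{semiring_0, monoid_mult} set"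
  assumes cid: "common_integer_divisor TYPE('s)" and "finite F"
  shows "\<exists>r. invertible_elem r \<and> F \<subseteq> range (\<lambda>m. nat_multiple m r)"
  using \<open>finite F\<close>
proof (induction F)
  case empty
  have "invertible_elem (1::'s)"
    by (auto simp: invertible_elem_def)
  then show ?case by blast
next
  case (insert x F)
  then obtain r where F: "F \<subseteq> range (\<lambda>m. nat_multiple m r)" by blast
  from cid obtain q m k where q: "invertible_elem q" "r = nat_multiple m q" "x = nat_multiple k q"
    unfolding common_integer_divisor_def by blast
  have "F \<subseteq> range (\<lambda>m. nat_multiple m q)"
    using F q(2) by (auto simp flip: nat_multiple_mult)
  then show ?case using q by blast
qed

text \<open>The collision leaves at most \<open>h\<close> distinct multiples of 1, hence of any
  \<open>r\<close>. Every finite set consists of multiples of a single \<open>r\<close>, so none can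
  have \<open>h + 1\<close> elements.\<close>

lemma finite_if_multiples_of_one_collide:
  assumes cid: "common_integer_divisor TYPE('s::{semiring_0, monoid_mult})"
    and "l < h" and eq: "nat_multiple l (1::'s) = nat_multiple h 1"
  shows "finite (UNIV :: 's set)"
proof (rule ccontr)
  assume "infinite (UNIV :: 's set)"
  then obtain F :: "'s set" where F: "finite F" "card F = Suc h"
    using infinite_arbitrarily_large by blast
  \<comment> \<open>As long as \<open>m\<close> is at least \<open>h\<close>, trading
    \<open>h\<close> ones for \<open>l\<close> ones lowers \<open>m\<close> without changing the
    multiple.\<close>
  have red: "\<exists>k<h. nat_multiple m (1::'s) = nat_multiple k 1" for m
  proof (induction m rule: less_induct)
    case (less m)
    show ?case
    proof (cases "m < h")
      case False
      then have m: "m = h + (m - h)" by simp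
      have "nat_multiple m (1::'s) = nat_multiple (l + (m - h)) 1"
        by (subst m) (simp only: nat_multiple_add eq)
      moreover have "l + (m - h) < m"
        using \<open>l < h\<close> False by simp
      ultimately show ?thesis using less by metis
    qed blast
  qed
  obtain r where r: "F \<subseteq> range (\<lambda>m. nat_multiple m r)"
    using common_divisor_finite_set[OF cid F(1)] by blast
  have "F \<subseteq> (\<lambda>m. nat_multiple m r) ` {..<h}"
  proof
    fix x assume "x \<in> F"
    then obtain m where m: "x = nat_multiple m r" using r by blast
    obtain k where "k < h" "nat_multiple m (1::'s) = nat_multiple k 1" using red by blast
    then have "x = nat_multiple k r"
      using m nat_multiple_one_mult[of m r] nat_multiple_one_mult[of k r] by simp
    with \<open>k < h\<close> show "x \<in> (\<lambda>m. nat_multiple m r) ` {..<h}" by blast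
  qed
  then have "card F \<le> h"
    by (metis card_image_le card_lessThan card_mono dual_order.trans finite_imageI finite_lessThan)
  with F show False by simp
qed

text \<open>Dividing by a common unit turns the equation into one between multiples of 1. Unless
  \<open>a = b\<close>, it is a collision, so the semiring is finite and by assumption some positive
  multiple of 1 vanishes, which allows subtraction. The assumption excludes the Booleans, where 1 +
  1 = 1 + 0.\<close>

lemma additively_cancellative:
  fixes x y z :: "'s::{semiring_0, monoid_mult}"
  assumes cid: "common_integer_divisor TYPE('s)"
    and "infinite (UNIV :: 's set) \<or> (\<exists>k>0. nat_multiple k (1::'s) = 0)"
    and eq: "z + x = z + y"
  shows "x = y"
proof -
  obtain r where r: "invertible_elem r" "{x, y, z} \<subseteq> range (\<lambda>m. nat_multiple m r)"
    using common_divisor_finite_set[OF cid, of "{x, y, z}"] by auto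
  then obtain a b c where abc: "x = nat_multiple a r" "y = nat_multiple b r" "z = nat_multiple c r"
    by auto
  obtain s where s: "r * s = 1"
    using r(1) by (auto simp: invertible_elem_def)
  have "nat_multiple (c + a) r * s = nat_multiple (c + b) r * s"
    using eq abc by (simp add: nat_multiple_add)
  then have one: "nat_multiple (c + a) (1::'s) = nat_multiple (c + b) 1"
    by (simp add: nat_multiple_mult_left s)
  show ?thesis
  proof (cases "a = b")
    case False
    then have "c + a < c + b \<or> c + b < c + a" by auto
    then have "finite (UNIV :: 's set)"
      using finite_if_multiples_of_one_collide[OF cid] one by metis
    then obtain k where k: "k > 0" "nat_multiple k (1::'s) = 0"
      using assms(2) by blast
    have drop: "nat_multiple (k * c) (1::'s) = 0"
      by (subst mult.commute) (simp only: nat_multiple_mult k nat_multiple_zero)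
    have split: "k * c = (k - 1) * c + c"
      using k(1) by (cases k) auto
    have "nat_multiple ((k - 1) * c) (1::'s) + nat_multiple (c + a) 1 =
          nat_multiple ((k - 1) * c) 1 + nat_multiple (c + b) 1"
      using one by simp
    then have "nat_multiple (k * c) (1::'s) + nat_multiple a 1 =
               nat_multiple (k * c) 1 + nat_multiple b 1"
      by (simp only: split nat_multiple_add add.assoc)
    then have "nat_multiple a (1::'s) = nat_multiple b 1"
      by (simp add: drop)
    then have "nat_multiple a (1::'s) * r = nat_multiple b 1 * r" by simp
    then show ?thesis
      using abc by (simp add: nat_multiple_one_mult)
  qed (simp add: abc)
qed

text \<open>If a total weight has this form, a unit can be placed at one point and the rest at
  another; a transformation then reveals its coefficient.\<close>

definition unit_summand :: "'s::{semiring_0, monoid_mult} \<Rightarrow> bool" where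
  "unit_summand x \<longleftrightarrow> (\<exists>r s. invertible_elem r \<and> x = r + s)"

lemma unit_summand_nonzero:
  fixes x :: "'s::{semiring_0, monoid_mult}"
  assumes "common_integer_divisor TYPE('s)" "x \<noteq> 0"
  shows "unit_summand x"
proof -
  obtain r m where r: "invertible_elem r" "x = nat_multiple m r"
    using assms(1) unfolding common_integer_divisor_def by blast
  with \<open>x \<noteq> 0\<close> obtain m' where "m = Suc m'" by (cases m) auto
  with r show ?thesis unfolding unit_summand_def by auto
qed

lemma unit_summand_zero:
  assumes "k > 0" "nat_multiple k (1::'s::{semiring_0, monoid_mult}) = 0"
  shows "unit_summand (0::'s)"
proof -
  obtain k' where "k = Suc k'" using \<open>k > 0\<close> by (cases k) auto
  then have "0 = 1 + nat_multiple k' (1::'s)" using assms(2) by simp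
  moreover have "invertible_elem (1::'s)"
    by (auto simp: invertible_elem_def)
  ultimately show ?thesis unfolding unit_summand_def by blast
qed

section \<open>Finitely supported functions\<close>

text \<open>Makes the index set independent of \<open>y\<close> and, within a tuple, of the
  component, so that sums can be swapped.\<close>

lemma mset_map_eq_sum:
  assumes "finite A" "{x. \<phi> x \<noteq> 0} \<subseteq> A"
  shows "mset_map f \<phi> y = (\<Sum>x\<in>A. if f x = y then \<phi> x else 0)"
proof -
  have "(\<Sum>x | \<phi> x \<noteq> 0 \<and> f x = y. \<phi> x) = (\<Sum>x\<in>{x \<in> A. f x = y}. \<phi> x)"
    using assms by (intro sum.mono_neutral_left) auto
  also have "\<dots> = (\<Sum>x\<in>A. if f x = y then \<phi> x else 0)"
    using assms(1) by (rule sum.inter_filter)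
  finally show ?thesis by (simp add: mset_map_def)
qed

lemma mset_map_id: "mset_map (\<lambda>x. x) \<phi> = \<phi>"
proof
  fix y
  have "{x. \<phi> x \<noteq> 0 \<and> x = y} = (if \<phi> y = 0 then {} else {y})" by auto
  then show "mset_map (\<lambda>x. x) \<phi> y = \<phi> y" by (simp add: mset_map_def)
qed

lemma support_mset_map: "{y. mset_map f \<phi> y \<noteq> 0} \<subseteq> f ` {x. \<phi> x \<noteq> 0}"
proof
  fix y assume "y \<in> {y. mset_map f \<phi> y \<noteq> 0}"
  then have "{x. \<phi> x \<noteq> 0 \<and> f x = y} \<noteq> {}"
    unfolding mset_map_def by force
  then show "y \<in> f ` {x. \<phi> x \<noteq> 0}" by auto
qed

lemma mset_map_in_obj:
  assumes "f \<in> X \<rightarrow> Y" "\<phi> \<in> mset_obj X"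
  shows "mset_map f \<phi> \<in> mset_obj Y"
  using assms finite_subset[OF support_mset_map[of f \<phi>]] support_mset_map[of f \<phi>]
  by (fastforce simp: mset_obj_def)

lemma mset_obj_mono: "X \<subseteq> Y \<Longrightarrow> mset_obj X \<subseteq> mset_obj Y"
  by (auto simp: mset_obj_def)

definition total :: "('u \<Rightarrow> 's::comm_monoid_add) \<Rightarrow> 's" where
  "total \<phi> = (\<Sum>x | \<phi> x \<noteq> 0. \<phi> x)"

lemma total_eq_sum:
  assumes "finite A" "{x. \<phi> x \<noteq> 0} \<subseteq> A"
  shows "total \<phi> = sum \<phi> A"
  unfolding total_def using assms by (intro sum.mono_neutral_left) auto

text \<open>Each point contributes to exactly one fibre. Totals are therefore invariants on which
  coefficients may depend.\<close>

lemma total_mset_map: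
  assumes "finite {x. \<phi> x \<noteq> 0}"
  shows "total (mset_map f \<phi>) = total \<phi>"
proof -
  let ?A = "{x. \<phi> x \<noteq> 0}"
  have "total (mset_map f \<phi>) = (\<Sum>y\<in>f ` ?A. \<Sum>x\<in>?A. if f x = y then \<phi> x else 0)"
    using assms by (subst total_eq_sum[OF _ support_mset_map]) (auto simp: mset_map_eq_sum[of ?A])
  also have "\<dots> = (\<Sum>x\<in>?A. \<Sum>y\<in>f ` ?A. if f x = y then \<phi> x else 0)"
    by (rule sum.swap)
  also have "\<dots> = total \<phi>"
    unfolding total_def using assms by (intro sum.cong) (auto simp: sum.delta')
  finally show ?thesis .
qed

lemma power_obj_memD:
  assumes "t \<in> power_obj n mset_obj X" "i < n"
  shows "t i \<in> mset_obj X" "finite {x. t i x \<noteq> 0}" "{x. t i x \<noteq> 0} \<subseteq> X"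
  using assms by (auto simp: power_obj_def mset_obj_def PiE_iff)

section \<open>Transformations defined by functions on tuples\<close>

definition tuple_total :: "nat \<Rightarrow> (nat \<Rightarrow> 'u \<Rightarrow> 's::comm_monoid_add) \<Rightarrow> nat \<Rightarrow> 's" where
  "tuple_total n t = (\<lambda>i\<in>{..<n}. total (t i))"

definition weighted_sum ::
    "nat \<Rightarrow> ((nat \<Rightarrow> 's) \<Rightarrow> nat \<Rightarrow> 's) \<Rightarrow> (nat \<Rightarrow> 'u \<Rightarrow> 's::semiring_0) \<Rightarrow> 'u \<Rightarrow> 's" where
  "weighted_sum n \<psi> t = (\<lambda>x. \<Sum>i<n. t i x * \<psi> (tuple_total n t) i)"

definition transformation_of ::
    "nat \<Rightarrow> ((nat \<Rightarrow> 's) \<Rightarrow> nat \<Rightarrow> 's) \<Rightarrow> 'u set \<Rightarrow> (nat \<Rightarrow> 'u \<Rightarrow> 's::semiring_0) \<Rightarrow> 'u \<Rightarrow> 's" where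
  "transformation_of n \<psi> X = restrict (weighted_sum n \<psi>) (power_obj n mset_obj X)"

lemma support_weighted_sum:
  "{x. weighted_sum n \<psi> t x \<noteq> 0} \<subseteq> (\<Union>i<n. {x. t i x \<noteq> 0})"
proof
  fix x assume "x \<in> {x. weighted_sum n \<psi> t x \<noteq> 0}"
  then obtain i where "i < n" "t i x * \<psi> (tuple_total n t) i \<noteq> 0"
    by (auto simp: weighted_sum_def elim: sum.not_neutral_contains_not_neutral)
  moreover from this have "t i x \<noteq> 0" by auto
  ultimately show "x \<in> (\<Union>i<n. {x. t i x \<noteq> 0})" by blast
qed

lemma weighted_sum_in_obj:
  assumes "t \<in> power_obj n mset_obj X"
  shows "weighted_sum n \<psi> t \<in> mset_obj X"
proof -
  have "finite (\<Union>i<n. {x. t i x \<noteq> 0})" "(\<Union>i<n. {x. t i x \<noteq> 0}) \<subseteq> X"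
    using power_obj_memD(2,3)[OF assms] by auto
  then show ?thesis
    using finite_subset[OF support_weighted_sum[of n \<psi> t]] support_weighted_sum[of n \<psi> t]
    by (auto simp: mset_obj_def)
qed

lemma power_map_in_obj:
  assumes "f \<in> X \<rightarrow> Y" "t \<in> power_obj n mset_obj X"
  shows "power_map n mset_map f t \<in> power_obj n mset_obj Y"
  using assms mset_map_in_obj[OF assms(1)] by (auto simp: power_obj_def power_map_def)

text \<open>Maps preserve the totals and hence the coefficients; for fixed coefficients, the sum
  over components commutes with the sum over a fibre.\<close>

lemma weighted_sum_natural:
  assumes "t \<in> power_obj n mset_obj X"
  shows "weighted_sum n \<psi> (power_map n mset_map f t) = mset_map f (weighted_sum n \<psi> t)"
proof
  fix y
  define A where "A = (\<Union>i<n. {x. t i x \<noteq> 0})"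
  have A: "finite A" using power_obj_memD(2)[OF assms] by (auto simp: A_def)
  have map: "mset_map f (t i) y = (\<Sum>x\<in>A. if f x = y then t i x else 0)" if "i < n" for i
    using A that by (intro mset_map_eq_sum) (auto simp: A_def)
  have tot: "tuple_total n (power_map n mset_map f t) = tuple_total n t"
    using power_obj_memD(2)[OF assms]
    by (auto simp: tuple_total_def power_map_def total_mset_map)
  have "weighted_sum n \<psi> (power_map n mset_map f t) y =
      (\<Sum>i<n. (\<Sum>x\<in>A. if f x = y then t i x else 0) * \<psi> (tuple_total n t) i)"
    using map by (simp add: weighted_sum_def tot) (simp add: power_map_def)
  also have "\<dots> = (\<Sum>i<n. \<Sum>x\<in>A. if f x = y then t i x * \<psi> (tuple_total n t) i else 0)"
    by (auto simp: sum_distrib_right intro!: sum.cong)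
  also have "\<dots> = (\<Sum>x\<in>A. \<Sum>i<n. if f x = y then t i x * \<psi> (tuple_total n t) i else 0)"
    by (rule sum.swap)
  also have "\<dots> = (\<Sum>x\<in>A. if f x = y then weighted_sum n \<psi> t x else 0)"
    by (auto simp: weighted_sum_def intro!: sum.cong)
  also have "\<dots> = mset_map f (weighted_sum n \<psi> t) y"
    using A support_weighted_sum[of n \<psi> t] by (intro mset_map_eq_sum[symmetric]) (auto simp: A_def)
  finally show "weighted_sum n \<psi> (power_map n mset_map f t) y = mset_map f (weighted_sum n \<psi> t) y" .
qed

lemma transformation_of_natural:
  "transformation_of n \<psi> \<in>
     natural_transformations (power_obj n mset_obj) (power_map n mset_map) mset_obj mset_map"
  unfolding natural_transformations_def mem_Collect_eq
proof (intro conjI allI ballI)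
  fix X Y :: "'a set" and f :: "'a \<Rightarrow> 'a" and t :: "nat \<Rightarrow> 'a \<Rightarrow> 'b"
  assume "f \<in> X \<rightarrow> Y" "t \<in> power_obj n mset_obj X"
  then show "transformation_of n \<psi> Y (power_map n mset_map f t) =
      mset_map f (transformation_of n \<psi> X t)"
    using weighted_sum_natural[of t n X \<psi> f] power_map_in_obj[of f X Y t n]
    by (simp add: transformation_of_def)
qed (auto simp: transformation_of_def weighted_sum_in_obj)

section \<open>Two-point configurations\<close>

definition two_point :: "nat \<Rightarrow> 'u \<Rightarrow> 'u \<Rightarrow> (nat \<Rightarrow> 's) \<Rightarrow> (nat \<Rightarrow> 's) \<Rightarrow> nat \<Rightarrow> 'u \<Rightarrow> 's::comm_monoid_add" where
  "two_point n a b v w = (\<lambda>i\<in>{..<n}. (\<lambda>x. 0)(b := w i, a := v i))"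

lemma support_update2: "{x. ((\<lambda>x. 0)(b := w, a := v)) x \<noteq> 0} \<subseteq> {a, b}"
  by auto

lemma two_point_in_obj: "two_point n a b v w \<in> power_obj n mset_obj UNIV"
  using finite_subset[OF support_update2]
  by (auto simp: two_point_def power_obj_def mset_obj_def simp del: fun_upd_apply)

lemma tuple_total_two_point:
  assumes "a \<noteq> b"
  shows "tuple_total n (two_point n a b v w) = (\<lambda>i\<in>{..<n}. v i + w i)"
  unfolding tuple_total_def two_point_def
  using assms by (intro restrict_ext) (simp add: total_eq_sum[OF _ support_update2])

lemma weighted_sum_two_point:
  assumes "a \<noteq> b"
  shows "weighted_sum n \<psi> (two_point n a b v w) a = (\<Sum>i<n. v i * \<psi> (\<lambda>i\<in>{..<n}. v i + w i) i)"
  by (simp add: weighted_sum_def tuple_total_two_point[OF assms]) (simp add: two_point_def)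

section \<open>Two-point values of a natural transformation\<close>

locale multiset_transformation =
  fixes n :: nat and \<alpha> :: "'u set \<Rightarrow> (nat \<Rightarrow> 'u \<Rightarrow> 's::semiring_0) \<Rightarrow> 'u \<Rightarrow> 's"
    and a b c :: 'u
  assumes natural: "\<alpha> \<in> natural_transformations (power_obj n mset_obj) (power_map n mset_map)
      mset_obj mset_map"
    and distinct: "a \<noteq> b" "a \<noteq> c" "b \<noteq> c"
begin

lemma in_obj: "t \<in> power_obj n mset_obj X \<Longrightarrow> \<alpha> X t \<in> mset_obj X"
  using natural by (auto simp: natural_transformations_def PiE_iff)

lemma extensional: "t \<notin> power_obj n mset_obj X \<Longrightarrow> \<alpha> X t = undefined"
  using natural by (auto simp: natural_transformations_def PiE_iff extensional_def)

lemma naturality: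
  "f \<in> X \<rightarrow> Y \<Longrightarrow> t \<in> power_obj n mset_obj X \<Longrightarrow>
     \<alpha> Y (power_map n mset_map f t) = mset_map f (\<alpha> X t)"
  using natural unfolding natural_transformations_def by blast

text \<open>Naturality along the inclusion of \<open>X\<close>, which acts as the identity because
  functions are extended by 0.\<close>

lemma eq_UNIV:
  assumes "t \<in> power_obj n mset_obj X"
  shows "\<alpha> X t = \<alpha> UNIV t"
proof -
  have "power_map n mset_map (\<lambda>x. x) t = t"
    using assms by (auto simp: power_map_def mset_map_id power_obj_def)
  then show ?thesis
    using naturality[of "\<lambda>x. x" X UNIV t] assms by (simp add: mset_map_id)
qed

text \<open>The tuple already lives over the complement of \<open>x\<close>, and so does its
  image.\<close>

lemma zero_outside_support:
  assumes "t \<in> power_obj n mset_obj UNIV" "\<And>i. i < n \<Longrightarrow> t i x = 0"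
  shows "\<alpha> UNIV t x = 0"
proof -
  have "t \<in> power_obj n mset_obj (-{x})"
    using assms by (auto simp: power_obj_def mset_obj_def PiE_iff)
  from in_obj[OF this] eq_UNIV[OF this] show ?thesis
    by (auto simp: mset_obj_def)
qed

definition G :: "(nat \<Rightarrow> 's) \<Rightarrow> (nat \<Rightarrow> 's) \<Rightarrow> 's" where
  "G v w = \<alpha> UNIV (two_point n a b v w) a"

lemma G_cong:
  assumes "\<And>i. i < n \<Longrightarrow> v i = v' i" "\<And>i. i < n \<Longrightarrow> w i = w' i"
  shows "G v w = G v' w'"
proof -
  have "two_point n a b v w = two_point n a b v' w'"
    unfolding two_point_def using assms by (intro restrict_ext) auto
  then show ?thesis by (simp add: G_def)
qed

lemma G_zero: "(\<And>i. i < n \<Longrightarrow> v i = 0) \<Longrightarrow> G v w = 0"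
  unfolding G_def by (rule zero_outside_support[OF two_point_in_obj]) (simp add: two_point_def)

text \<open>Naturality along the map sending \<open>x\<close> to \<open>a\<close> and all else to
  \<open>b\<close>: the fibre of \<open>a\<close> is \<open>{x}\<close>, so the value at
  \<open>x\<close> survives unchanged.\<close>

lemma value_eq_G:
  assumes t: "t \<in> power_obj n mset_obj UNIV"
    and A: "finite A" "\<And>i. i < n \<Longrightarrow> {y. t i y \<noteq> 0} \<subseteq> A"
  shows "\<alpha> UNIV t x = G (\<lambda>i. t i x) (\<lambda>i. \<Sum>y\<in>A - {x}. t i y)"
proof -
  define f where "f = (\<lambda>y. if y = x then a else b)"
  have map: "mset_map f (t i) = (\<lambda>x. 0)(b := (\<Sum>y\<in>A - {x}. t i y), a := t i x)" if "i < n" for i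
  proof
    fix z
    \<comment> \<open>The point \<open>x\<close> may lie outside \<open>A\<close>.\<close>
    have "mset_map f (t i) z = (\<Sum>y\<in>insert x A. if f y = z then t i y else 0)"
      using A that by (intro mset_map_eq_sum) auto
    also have "\<dots> = (if a = z then t i x else 0) + (\<Sum>y\<in>A - {x}. if b = z then t i y else 0)"
      using A by (simp add: sum.insert_remove f_def)
    finally show "mset_map f (t i) z = ((\<lambda>x. 0)(b := (\<Sum>y\<in>A - {x}. t i y), a := t i x)) z"
      using distinct by auto
  qed
  have "power_map n mset_map f t = two_point n a b (\<lambda>i. t i x) (\<lambda>i. \<Sum>y\<in>A - {x}. t i y)"
    unfolding power_map_def two_point_def using map by (intro restrict_ext) auto
  then have "G (\<lambda>i. t i x) (\<lambda>i. \<Sum>y\<in>A - {x}. t i y) = mset_map f (\<alpha> UNIV t) a"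
    using naturality[OF _ t, of f UNIV] by (simp add: G_def)
  also have "{y. \<alpha> UNIV t y \<noteq> 0 \<and> f y = a} = (if \<alpha> UNIV t x = 0 then {} else {x})"
    using distinct by (auto simp: f_def)
  then have "mset_map f (\<alpha> UNIV t) a = \<alpha> UNIV t x"
    by (simp add: mset_map_def)
  finally show ?thesis by simp
qed

text \<open>Put weights \<open>v\<close>, \<open>v'\<close>, \<open>w\<close> at \<open>a\<close>,
  \<open>b\<close>, \<open>c\<close>. Naturality along \<open>f\<close>, which merges
  \<open>b\<close> into \<open>a\<close> and moves \<open>c\<close> to \<open>b\<close>, equates the
  value at \<open>a\<close> after merging with the sum of the values at \<open>a\<close> and
  \<open>b\<close> before.\<close>

lemma G_add: "G (\<lambda>i. v i + v' i) w = G v (\<lambda>i. v' i + w i) + G v' (\<lambda>i. v i + w i)"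
proof -
  define t where "t = (\<lambda>i\<in>{..<n}. (\<lambda>x. 0)(c := w i, b := v' i, a := v i))"
  define f where "f = (\<lambda>y. if y = a \<or> y = b then a else b)"
  have supp: "{x. t i x \<noteq> 0} \<subseteq> {a, b, c}" if "i < n" for i
    using that by (auto simp: t_def)
  have t: "t \<in> power_obj n mset_obj UNIV"
    using finite_subset[OF supp] by (auto simp: t_def power_obj_def mset_obj_def)
  have val: "\<alpha> UNIV t x = G (\<lambda>i. t i x) (\<lambda>i. \<Sum>y\<in>{a, b, c} - {x}. t i y)" for x
    by (rule value_eq_G[OF t _ supp]) auto
  have rest: "{a, b, c} - {a} = {b, c}" "{a, b, c} - {b} = {a, c}"
    using distinct by auto
  have at_a: "\<alpha> UNIV t a = G v (\<lambda>i. v' i + w i)" and at_b: "\<alpha> UNIV t b = G v' (\<lambda>i. v i + w i)"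
    unfolding val rest using distinct by (auto intro!: G_cong simp: t_def)
  have "mset_map f (t i) = (\<lambda>x. 0)(b := w i, a := v i + v' i)" if "i < n" for i
  proof
    fix z
    show "mset_map f (t i) z = ((\<lambda>x. 0)(b := w i, a := v i + v' i)) z"
      using distinct that by (subst mset_map_eq_sum[OF _ supp]) (auto simp: f_def t_def)
  qed
  then have "power_map n mset_map f t = two_point n a b (\<lambda>i. v i + v' i) w"
    unfolding power_map_def two_point_def by (intro restrict_ext) auto
  then have "G (\<lambda>i. v i + v' i) w = mset_map f (\<alpha> UNIV t) a"
    using naturality[OF _ t, of f UNIV] by (simp add: G_def)
  also have "\<dots> = (\<Sum>x\<in>{a, b, c}. if f x = a then \<alpha> UNIV t x else 0)"
  proof (intro mset_map_eq_sum subsetI)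
    fix x assume x: "x \<in> {x. \<alpha> UNIV t x \<noteq> 0}"
    show "x \<in> {a, b, c}"
    proof (rule ccontr)
      assume "x \<notin> {a, b, c}"
      then have "\<alpha> UNIV t x = 0"
        using supp by (intro zero_outside_support[OF t]) auto
      with x show False by simp
    qed
  qed simp
  also have "\<dots> = \<alpha> UNIV t a + \<alpha> UNIV t b"
    using distinct by (auto simp: f_def)
  finally show ?thesis by (simp add: at_a at_b)
qed

definition single :: "nat \<Rightarrow> 's \<Rightarrow> nat \<Rightarrow> 's" where
  "single i r = (\<lambda>j. 0)(i := r)"

text \<open>Copies of \<open>r\<close> are split off one by one with \<open>G_add\<close>. Each sees
  the other \<open>m - 1\<close> copies at the second point, so all \<open>m\<close> terms
  agree.\<close>

lemma G_multiple:
  "G (single i (nat_multiple m r)) (w(i := s)) =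
     nat_multiple m (G (single i r) (w(i := s + nat_multiple (m - 1) r)))"
proof (induction m arbitrary: s)
  case 0
  then show ?case by (simp add: G_zero single_def)
next
  case (Suc m)
  have "G (single i (nat_multiple (Suc m) r)) (w(i := s)) =
      G (\<lambda>j. single i r j + single i (nat_multiple m r) j) (w(i := s))"
    by (rule G_cong) (auto simp: single_def)
  also have "\<dots> = G (single i r) (\<lambda>j. single i (nat_multiple m r) j + (w(i := s)) j) +
      G (single i (nat_multiple m r)) (\<lambda>j. single i r j + (w(i := s)) j)"
    by (rule G_add)
  also have "G (single i r) (\<lambda>j. single i (nat_multiple m r) j + (w(i := s)) j) =
      G (single i r) (w(i := s + nat_multiple m r))"
    by (rule G_cong) (auto simp: single_def add.commute)
  also have "G (single i (nat_multiple m r)) (\<lambda>j. single i r j + (w(i := s)) j) =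
      G (single i (nat_multiple m r)) (w(i := s + r))"
    by (rule G_cong) (auto simp: single_def add.commute)
  \<comment> \<open>For \<open>m = 0\<close> the truncated \<open>m - 1\<close> is harmless, as both
    sides are empty sums.\<close>
  also have "\<dots> = nat_multiple m (G (single i r) (w(i := s + nat_multiple m r)))"
    unfolding Suc by (cases m) (simp_all add: add.assoc)
  finally show ?case by (simp only: nat_multiple_Suc diff_Suc_1)
qed

text \<open>Component \<open>k\<close> is split off with \<open>G_add\<close>. In the term for
  \<open>i\<close> all other components of \<open>v\<close> have moved to the second point, so only
  entry \<open>i\<close> there is still \<open>w i\<close>.\<close>

lemma G_split:
  assumes "k \<le> n"
  shows "G (\<lambda>j. if j < k then v j else 0) w =
    (\<Sum>i<k. G (single i (v i)) ((\<lambda>j. (if j < k then v j else 0) + w j)(i := w i)))"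
  using assms
proof (induction k arbitrary: w)
  case 0
  then show ?case by (simp add: G_zero)
next
  case (Suc k)
  have "G (\<lambda>j. if j < Suc k then v j else 0) w =
      G (\<lambda>j. (if j < k then v j else 0) + single k (v k) j) w"
    by (rule G_cong) (auto simp: single_def)
  also have "\<dots> = G (\<lambda>j. if j < k then v j else 0) (\<lambda>j. single k (v k) j + w j) +
      G (single k (v k)) (\<lambda>j. (if j < k then v j else 0) + w j)"
    by (rule G_add)
  also have "G (\<lambda>j. if j < k then v j else 0) (\<lambda>j. single k (v k) j + w j) =
      (\<Sum>i<k. G (single i (v i)) ((\<lambda>j. (if j < Suc k then v j else 0) + w j)(i := w i)))"
    unfolding Suc.IH[OF Suc_leD[OF Suc.prems]]
    by (intro sum.cong G_cong) (auto simp: single_def less_Suc_eq)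
  also have "G (single k (v k)) (\<lambda>j. (if j < k then v j else 0) + w j) =
      G (single k (v k)) ((\<lambda>j. (if j < Suc k then v j else 0) + w j)(k := w k))"
    by (rule G_cong) auto
  finally show ?case by (simp only: sum.lessThan_Suc)
qed

end

section \<open>The function on tuples defined by a transformation\<close>

text \<open>Under the common divisor property every nonzero weight has a unit summand, and so does
  any total containing it. Where the total has none, all weights are 0 and \<psi> is invisible;
  fixing it as 0 makes \<open>transformation_of\<close> injective.\<close>

definition admissible :: "nat \<Rightarrow> ((nat \<Rightarrow> 's) \<Rightarrow> nat \<Rightarrow> 's::{semiring_0, monoid_mult}) set" where
  "admissible n = {\<psi> \<in> tuples n \<rightarrow>\<^sub>E tuples n.
     \<forall>t \<in> tuples n. \<forall>i<n. \<not> unit_summand (t i) \<longrightarrow> \<psi> t i = 0}"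

locale cancellative_transformation = multiset_transformation n \<alpha> a b c
  for n and \<alpha> :: "'u set \<Rightarrow> (nat \<Rightarrow> 'u \<Rightarrow> 's::{semiring_0, monoid_mult}) \<Rightarrow> 'u \<Rightarrow> 's" and a b c +
  assumes common_divisor: "common_integer_divisor TYPE('s)"
    and cancel: "(z::'s) + x = z + y \<Longrightarrow> x = y"
begin

text \<open>Both units are multiples of one unit \<open>q\<close>, and \<open>G_multiple\<close>
  expresses both values through the same value at \<open>q\<close>, provided the remainders agree;
  this is where cancellation enters.\<close>

lemma G_unit_independent:
  assumes r: "invertible_elem r" "r * r1 = 1" "r1 * r = 1"
    and r': "invertible_elem r'" "r' * r1' = 1" "r1' * r' = 1"
    and eq: "r + s = r' + s'"
  shows "r1 * G (single i r) (t(i := s)) = r1' * G (single i r') (t(i := s'))"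
proof (cases "invertible_elem (0::'s)")
  case True
  then show ?thesis by (rule trivial_if_zero_invertible)
next
  case False
  obtain q m m' where q: "invertible_elem q" "r = nat_multiple m q" "r' = nat_multiple m' q"
    using common_divisor unfolding common_integer_divisor_def by blast
  obtain q1 where q1: "q * q1 = 1"
    using q(1) by (auto simp: invertible_elem_def)
  obtain k k' where k: "m = Suc k" "m' = Suc k'"
    using False q r(1) r'(1) by (cases m; cases m') auto
  \<comment> \<open>The sides are \<open>r + s\<close> and \<open>r' + s'\<close>. Cancelling
    \<open>q\<close> leaves the second weights produced by \<open>G_multiple\<close>.\<close>
  have "q + (s + nat_multiple k q) = q + (s' + nat_multiple k' q)"
    using eq q k by (simp add: ac_simps)
  then have ss: "s + nat_multiple k q = s' + nat_multiple k' q"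
    by (rule cancel)
  \<comment> \<open>Since \<open>q * q1 = 1\<close>, the multiple \<open>nat_multiple l g\<close>
    equals \<open>p * (q1 * g)\<close>, and \<open>p1\<close> removes \<open>p\<close>.\<close>
  have *: "p1 * nat_multiple l g = q1 * g" if "p1 * p = 1" "p = nat_multiple l q" for p p1 l g
  proof -
    have "nat_multiple l g = p * (q1 * g)"
      unfolding that(2) nat_multiple_mult_left by (simp flip: mult.assoc add: q1)
    then show ?thesis
      using that(1) by (simp flip: mult.assoc)
  qed
  let ?g = "G (single i q) (t(i := s + nat_multiple k q))"
  have "G (single i r) (t(i := s)) = nat_multiple m ?g"
    unfolding q(2) G_multiple using k by simp
  moreover have "G (single i r') (t(i := s')) = nat_multiple m' ?g"
    unfolding q(3) G_multiple using k ss by simp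
  ultimately show ?thesis
    using *[OF r(3) q(2)] *[OF r'(3) q(3)] by simp
qed

definition coefficient :: "(nat \<Rightarrow> 's) \<Rightarrow> nat \<Rightarrow> 's" where
  "coefficient t i = (SOME d. \<forall>r s. invertible_elem r \<longrightarrow> t i = r + s \<longrightarrow>
     G (single i r) (t(i := s)) = r * d)"

text \<open>The witness \<open>r1 * G (single i r) (t(i := s))\<close> serves every other
  decomposition by \<open>G_unit_independent\<close>.\<close>

lemma coefficient:
  assumes "invertible_elem r" "t i = r + s"
  shows "G (single i r) (t(i := s)) = r * coefficient t i"
proof -
  obtain r1 where r1: "r * r1 = 1" "r1 * r = 1"
    using assms(1) by (auto simp: invertible_elem_def)
  have "\<forall>r' s'. invertible_elem r' \<longrightarrow> t i = r' + s' \<longrightarrow>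
     G (single i r') (t(i := s')) = r' * (r1 * G (single i r) (t(i := s)))"
  proof (intro allI impI)
    fix r' s' assume r': "invertible_elem r'" "t i = r' + s'"
    obtain r1' where r1': "r' * r1' = 1" "r1' * r' = 1"
      using r'(1) by (auto simp: invertible_elem_def)
    have "r1 * G (single i r) (t(i := s)) = r1' * G (single i r') (t(i := s'))"
      using assms r1 r' r1' by (intro G_unit_independent) auto
    then show "G (single i r') (t(i := s')) = r' * (r1 * G (single i r) (t(i := s)))"
      using r1' by (simp flip: mult.assoc)
  qed
  from someI[of "\<lambda>d. \<forall>r s. invertible_elem r \<longrightarrow> t i = r + s \<longrightarrow>
     G (single i r) (t(i := s)) = r * d", OF this]
  show ?thesis
    unfolding coefficient_def using assms by blast
qed

text \<open>Without a unit summand the condition defining \<open>coefficient\<close> is vacuous; the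
  default 0 ensures admissibility.\<close>

definition tuple_function :: "(nat \<Rightarrow> 's) \<Rightarrow> nat \<Rightarrow> 's" where
  "tuple_function = (\<lambda>t\<in>tuples n. \<lambda>i\<in>{..<n}. if unit_summand (t i) then coefficient t i else 0)"

lemma tuple_function_admissible: "tuple_function \<in> admissible n"
  unfolding admissible_def tuple_function_def by (auto simp: tuples_def)

text \<open>Extends \<open>coefficient\<close> from units to all weights by writing \<open>x\<close>
  as a multiple of a unit.\<close>

lemma G_single:
  assumes "t \<in> tuples n" "i < n" "t i = x + s"
  shows "G (single i x) (t(i := s)) = x * tuple_function t i"
proof -
  obtain r m where r: "invertible_elem r" "x = nat_multiple m r"
    using common_divisor unfolding common_integer_divisor_def by blast
  show ?thesis
  proof (cases m)
    case 0
    with r show ?thesis by (simp add: G_zero single_def)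
  next
    case (Suc k)
    have ti: "t i = r + (s + nat_multiple k r)"
      using assms(3) r(2) Suc by (simp add: ac_simps)
    then have "unit_summand (t i)"
      using r(1) unfolding unit_summand_def by blast
    then have fn: "tuple_function t i = coefficient t i"
      using assms by (simp add: tuple_function_def)
    have "G (single i x) (t(i := s)) =
        nat_multiple m (G (single i r) (t(i := s + nat_multiple k r)))"
      unfolding r(2) G_multiple using Suc by simp
    also have "\<dots> = nat_multiple m (r * coefficient t i)"
      using coefficient[where t = t and i = i, OF r(1) ti] by simp
    finally show ?thesis
      by (simp add: r(2) fn nat_multiple_mult_left)
  qed
qed

lemma G_eq_sum: "G v w = (\<Sum>i<n. v i * tuple_function (\<lambda>i\<in>{..<n}. v i + w i) i)"
proof -
  let ?t = "\<lambda>i\<in>{..<n}. v i + w i"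
  have "G v w = G (\<lambda>j. if j < n then v j else 0) w"
    by (rule G_cong) auto
  also have "\<dots> = (\<Sum>i<n. G (single i (v i)) (?t(i := w i)))"
    unfolding G_split[OF order_refl] by (intro sum.cong G_cong) auto
  also have "\<dots> = (\<Sum>i<n. v i * tuple_function ?t i)"
    by (intro sum.cong G_single) (auto simp: tuples_def)
  finally show ?thesis .
qed

text \<open>Surjectivity: \<open>value_eq_G\<close> reduces every value to \<open>G\<close>, and the
  two weights there add up to the totals of \<open>t\<close>. Outside the domain both sides are
  \<open>undefined\<close>.\<close>

lemma transformation_of_tuple_function: "transformation_of n tuple_function = \<alpha>"
proof (intro ext)
  fix X t x
  show "transformation_of n tuple_function X t x = \<alpha> X t x"
  proof (cases "t \<in> power_obj n mset_obj X")
    case False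
    then show ?thesis by (simp add: transformation_of_def extensional)
  next
    case True
    define A where "A = (\<Union>i<n. {x. t i x \<noteq> 0})"
    have A: "finite A" "\<And>i. i < n \<Longrightarrow> {y. t i y \<noteq> 0} \<subseteq> A"
      using power_obj_memD(2)[OF True] by (auto simp: A_def)
    have t: "t \<in> power_obj n mset_obj UNIV"
      using True mset_obj_mono[of X UNIV] by (auto simp: power_obj_def PiE_iff)
    have tot: "tuple_total n t = (\<lambda>i\<in>{..<n}. t i x + (\<Sum>y\<in>A - {x}. t i y))"
      unfolding tuple_total_def
    proof (intro restrict_ext)
      fix i assume "i \<in> {..<n}"
      then have "{y. t i y \<noteq> 0} \<subseteq> insert x A" using A(2)[of i] by auto
      then show "total (t i) = t i x + (\<Sum>y\<in>A - {x}. t i y)"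
        using A(1) by (subst total_eq_sum[of "insert x A"]) (auto simp: sum.insert_remove)
    qed
    have "\<alpha> X t x = G (\<lambda>i. t i x) (\<lambda>i. \<Sum>y\<in>A - {x}. t i y)"
      using eq_UNIV[OF True] value_eq_G[OF t A] by simp
    then show ?thesis
      using True by (simp add: G_eq_sum transformation_of_def weighted_sum_def tot)
  qed
qed

end

section \<open>Admissible functions correspond to natural transformations\<close>

text \<open>A two-point configuration with total \<open>t\<close> and a unit \<open>r\<close> in
  component \<open>i\<close> at \<open>a\<close> has value \<open>r * \<psi> t i\<close> there, and
  \<open>r\<close> can be cancelled.\<close>

lemma transformation_of_inj:
  fixes \<psi> \<psi>' :: "(nat \<Rightarrow> 's::{semiring_0, monoid_mult}) \<Rightarrow> nat \<Rightarrow> 's"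
  assumes \<psi>: "\<psi> \<in> admissible n" "\<psi>' \<in> admissible n"
    and "a \<noteq> (b::'u)"
    and eq: "(transformation_of n \<psi> :: 'u set \<Rightarrow> _) = transformation_of n \<psi>'"
  shows "\<psi> = \<psi>'"
proof -
  have "\<psi> t i = \<psi>' t i" if t: "t \<in> tuples n" and i: "i < n" for t i
  proof (cases "unit_summand (t i)")
    case False
    then show ?thesis using \<psi> t i by (simp add: admissible_def)
  next
    case True
    then obtain r s where r: "invertible_elem r" "t i = r + s"
      unfolding unit_summand_def by blast
    obtain r1 where r1: "r1 * r = 1"
      using r(1) by (auto simp: invertible_elem_def)
    let ?v = "(\<lambda>j. 0)(i := r)" and ?w = "t(i := s)"
    have t_eq: "(\<lambda>j\<in>{..<n}. ?v j + ?w j) = t"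
    proof
      fix j
      show "(\<lambda>j\<in>{..<n}. ?v j + ?w j) j = t j"
        using t r(2) by (cases "j < n") (auto simp: tuples_def PiE_iff extensional_def)
    qed
    have val: "transformation_of n \<chi> UNIV (two_point n a b ?v ?w) a = r * \<chi> t i" for \<chi>
    proof -
      have "transformation_of n \<chi> UNIV (two_point n a b ?v ?w) a = (\<Sum>j<n. ?v j * \<chi> t j)"
        by (simp only: transformation_of_def restrict_apply' two_point_in_obj
            weighted_sum_two_point[OF \<open>a \<noteq> b\<close>] t_eq)
      also have "\<dots> = (\<Sum>j<n. if j = i then r * \<chi> t j else 0)"
        by (rule sum.cong) auto
      finally show ?thesis using i by simp
    qed
    have "r * \<psi> t i = r * \<psi>' t i"
      using eq by (simp flip: val)
    then have "r1 * r * \<psi> t i = r1 * r * \<psi>' t i"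
      by (simp add: mult.assoc)
    then show ?thesis by (simp add: r1)
  qed
  moreover have fn: "\<psi> \<in> tuples n \<rightarrow>\<^sub>E ({..<n} \<rightarrow>\<^sub>E UNIV)" "\<psi>' \<in> tuples n \<rightarrow>\<^sub>E ({..<n} \<rightarrow>\<^sub>E UNIV)"
    using \<psi> by (simp_all add: admissible_def tuples_def)
  ultimately have "\<psi> t = \<psi>' t" if "t \<in> tuples n" for t
    using that by (intro PiE_ext[OF PiE_mem[OF fn(1)] PiE_mem[OF fn(2)]]) auto
  then show ?thesis
    by (rule PiE_ext[OF fn])
qed

lemma transformation_of_bij_betw:
  assumes "infinite (UNIV :: 'u set)"
    and cid: "common_integer_divisor TYPE('s::{semiring_0, monoid_mult})"
    and fin: "infinite (UNIV :: 's set) \<or> (\<exists>k>0. nat_multiple k (1::'s) = 0)"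
  shows "bij_betw (transformation_of n) (admissible n)
    (natural_transformations
       (power_obj n mset_obj :: 'u set \<Rightarrow> (nat \<Rightarrow> 'u \<Rightarrow> 's) set) (power_map n mset_map)
       mset_obj mset_map)"
proof -
  obtain F :: "'u set" where "card F = 3"
    using infinite_arbitrarily_large[OF assms(1)] by blast
  then obtain a b c :: 'u where abc: "a \<noteq> b" "a \<noteq> c" "b \<noteq> c"
    by (auto simp: card_3_iff)
  show ?thesis
    unfolding bij_betw_def
  proof (intro conjI equalityI subsetI)
    show "inj_on (transformation_of n :: _ \<Rightarrow> 'u set \<Rightarrow> (nat \<Rightarrow> 'u \<Rightarrow> 's) \<Rightarrow> _) (admissible n)"
      using transformation_of_inj[OF _ _ abc(1)] by (intro inj_onI) blast
  next
    fix \<alpha> :: "'u set \<Rightarrow> (nat \<Rightarrow> 'u \<Rightarrow> 's) \<Rightarrow> 'u \<Rightarrow> 's"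
    assume "\<alpha> \<in> natural_transformations (power_obj n mset_obj) (power_map n mset_map)
      mset_obj mset_map"
    then interpret cancellative_transformation n \<alpha> a b c
      using abc cid additively_cancellative[OF cid fin] by unfold_locales auto
    show "\<alpha> \<in> transformation_of n ` admissible n"
      using transformation_of_tuple_function tuple_function_admissible by (metis imageI)
  qed (use transformation_of_natural in auto)
qed

section \<open>Counting\<close>

lemma ex_inj_into_nonzero:
  assumes "infinite (UNIV :: 's::zero set)"
  shows "\<exists>j :: 's \<Rightarrow> 's. inj j \<and> (\<forall>x. j x \<noteq> 0)"
proof -
  obtain h :: "'s \<Rightarrow> 's" where "bij_betw h UNIV (UNIV - {0})"
    using infinite_imp_bij_betw[OF assms] by blast
  then have "inj h" "range h = UNIV - {0}"
    by (simp_all add: bij_betw_def)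
  then show ?thesis by blast
qed

text \<open>If 0 has a unit summand, admissibility is no restriction. Otherwise the semiring is
  infinite and Schroeder-Bernstein applies, with the inclusion in one direction and a re-encoding on
  tuples of nonzero entries in the other.\<close>

lemma admissible_equipollent:
  assumes cid: "common_integer_divisor TYPE('s::{semiring_0, monoid_mult})"
    and fin: "infinite (UNIV :: 's set) \<or> (\<exists>k>0. nat_multiple k (1::'s) = 0)"
  shows "\<exists>h. bij_betw h (admissible n :: ((nat \<Rightarrow> 's) \<Rightarrow> nat \<Rightarrow> 's) set)
    ((tuples n :: (nat \<Rightarrow> 's) set) \<rightarrow>\<^sub>E (tuples n :: (nat \<Rightarrow> 's) set))"
proof (cases "unit_summand (0::'s)")
  case True
  then have "unit_summand x" for x :: 's
    using unit_summand_nonzero[OF cid, of x] by (cases "x = 0") auto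
  then have "admissible n = (tuples n \<rightarrow>\<^sub>E tuples n :: ((nat \<Rightarrow> 's) \<Rightarrow> _) set)"
    by (simp add: admissible_def)
  then show ?thesis by (auto intro: bij_betw_id)
next
  case False
  then have "infinite (UNIV :: 's set)"
    using fin unit_summand_zero by blast
  then obtain j :: "'s \<Rightarrow> 's" where j: "inj j" "\<And>x. j x \<noteq> 0"
    using ex_inj_into_nonzero by blast
  \<comment> \<open>\<open>J\<close> embeds all tuples into those with nonzero entries, where
    admissibility imposes nothing.\<close>
  define J where "J t = (\<lambda>i\<in>{..<n}. j (t i))" for t
  have J_tuple: "J t \<in> tuples n" for t
    by (auto simp: J_def tuples_def)
  have J_inj: "t = t'" if "t \<in> tuples n" "t' \<in> tuples n" "J t = J t'" for t t'
  proof (rule PiE_ext)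
    show "t \<in> {..<n} \<rightarrow>\<^sub>E UNIV" "t' \<in> {..<n} \<rightarrow>\<^sub>E UNIV"
      using that by (simp_all add: tuples_def)
    fix i assume "i \<in> {..<n}"
    with fun_cong[OF that(3), of i] show "t i = t' i"
      using j(1) by (simp add: J_def inj_eq)
  qed
  \<comment> \<open>\<open>K\<close> transports \<psi> along \<open>J\<close> and takes the zero
    tuple off the image, so \<psi> can be recovered.\<close>
  define K :: "((nat \<Rightarrow> 's) \<Rightarrow> nat \<Rightarrow> 's) \<Rightarrow> (nat \<Rightarrow> 's) \<Rightarrow> nat \<Rightarrow> 's" where
    "K \<psi> = (\<lambda>t\<in>tuples n. if t \<in> J ` tuples n then \<psi> (inv_into (tuples n) J t) else (\<lambda>i\<in>{..<n}. 0))" for \<psi>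
  have J_inj_on: "inj_on J (tuples n)"
    using J_inj by (intro inj_onI) blast
  have K_J: "K \<psi> (J t) = \<psi> t" if "t \<in> tuples n" for \<psi> t
    using that J_tuple inv_into_f_f[OF J_inj_on that] by (simp add: K_def)
  have "inj_on K (tuples n \<rightarrow>\<^sub>E tuples n)"
  proof (rule inj_onI)
    fix \<psi> \<psi>' assume *: "\<psi> \<in> tuples n \<rightarrow>\<^sub>E tuples n" "\<psi>' \<in> tuples n \<rightarrow>\<^sub>E tuples n" "K \<psi> = K \<psi>'"
    have "\<psi> t = \<psi>' t" if "t \<in> tuples n" for t
      using K_J[OF that, of \<psi>] K_J[OF that, of \<psi>'] *(3) by simp
    then show "\<psi> = \<psi>'" by (rule PiE_ext[OF *(1,2)])
  qed
  moreover have "K \<psi> \<in> admissible n" if \<psi>: "\<psi> \<in> tuples n \<rightarrow>\<^sub>E tuples n" for \<psi>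
    unfolding admissible_def mem_Collect_eq
  proof (intro conjI ballI allI impI)
    have "\<psi> (inv_into (tuples n) J t) \<in> tuples n" if "t \<in> J ` tuples n" for t
      using PiE_mem[OF \<psi> inv_into_into[OF that]] .
    moreover have "(\<lambda>i\<in>{..<n}. 0) \<in> tuples n" by (simp add: tuples_def)
    ultimately show "K \<psi> \<in> tuples n \<rightarrow>\<^sub>E tuples n"
      unfolding K_def by (auto simp del: restrict_apply)
    fix t :: "nat \<Rightarrow> 's" and i assume t: "t \<in> tuples n" "i < n" "\<not> unit_summand (t i)"
    then have "t i = 0" using unit_summand_nonzero[OF cid, of "t i"] by argo
    then have "t \<notin> J ` tuples n" using t(2) j(2) by (auto simp: J_def)
    then show "K \<psi> t i = 0" using t by (simp add: K_def)
  qed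
  ultimately show ?thesis
    by (intro Schroeder_Bernstein[where f = "\<lambda>\<psi>. \<psi>" and g = K]) (auto simp: admissible_def)
qed

theorem theorem4p9:
  fixes n :: nat
  assumes "infinite (UNIV :: 'u set)"
    and "common_integer_divisor TYPE('s::{semiring_0, monoid_mult})"
    and "infinite (UNIV :: 's set) \<or> (\<exists>k>0. nat_multiple k (1::'s) = 0)"
  shows "\<exists>\<Theta>. bij_betw \<Theta>
    (natural_transformations
       (power_obj n mset_obj :: 'u set \<Rightarrow> (nat \<Rightarrow> 'u \<Rightarrow> 's) set) (power_map n mset_map)
       (mset_obj :: 'u set \<Rightarrow> ('u \<Rightarrow> 's) set) mset_map)
    ((tuples n :: (nat \<Rightarrow> 's) set) \<rightarrow>\<^sub>E (tuples n :: (nat \<Rightarrow> 's) set))"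
proof -
  obtain h where "bij_betw h (admissible n :: ((nat \<Rightarrow> 's) \<Rightarrow> nat \<Rightarrow> 's) set)
      ((tuples n :: (nat \<Rightarrow> 's) set) \<rightarrow>\<^sub>E (tuples n :: (nat \<Rightarrow> 's) set))"
    using admissible_equipollent[OF assms(2,3)] by blast
  \<comment> \<open>The inverse of \<open>transformation_of\<close> leads to admissible functions,
    and \<open>h\<close> from there to all functions.\<close>
  from bij_betw_trans[OF bij_betw_inv_into[OF transformation_of_bij_betw[OF assms]] this]
  show ?thesis by blast
qed

end
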